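(* Let $d\ge2$ be an even integer. Every classical LOCAL algorithm on the network $\mathscr{G}_d$ that uses $T\le d/4$ rounds (with no inputs, each node outputting one bit) generates a probability distribution over the joint outputs that is at total variation distance at least $1/11$ from $\Gamma_d$.
   Context: For even $d\ge2$, $G_d$ is the cycle on nodes $v_0,\dots,v_{3d-1}$ with edges $\{v_j,v_{j+1}\}$ (indices mod $3d$); $\mathscr{G}_d$ has node set $\{v_0,\dots,v_{3d-1}\}\cup\{w_0,w_1,w_2\}$ and the edges of $G_d$ together with $\{v_0,w_0\},\{v_d,w_1\},\{v_{2d},w_2\}$. Graph state of a graph: one qubit per node initialized to $|0\rangle$, Hadamard $\mathrm{H}=\frac1{\sqrt2}\begin{pmatrix}1&1\\1&-1\end{pmatrix}$ on each, then $\mathrm{CZ}=\mathrm{diag}(1,1,1,-1)$ on each pair of qubits forming an edge. For bits $b_0,b_1,b_2$, the process $\mathscr{P}_d(b_0,b_1,b_2)$: create the graph state of $G_d$; apply $\mathrm{S}^{b_i}$ ($\mathrm{S}=\mathrm{diag}(1,i)$) to the qubit of $v_{di}$ for $i=0,1,2$; apply $\mathrm{H}$ to every qubit; measure all qubits in the computational basis, the outcome at $v_j$ being a bit $m_j$. The distribution $\Gamma_d$ over outputs (one bit per node of $\mathscr{G}_d$) is: $b_0,b_1,b_2$ are independent uniformly random bits, node $w_i$ outputs $b_i$, and the nodes $v_0,\dots,v_{3d-1}$ output $(m_0,\dots,m_{3d-1})$ distributed as the measurement outcome of $\mathscr{P}_d(b_0,b_1,b_2)$. (This distribution is generated by a 2-round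 quantum LOCAL algorithm.) Classical LOCAL model: synchronous rounds; each node has a distinct identifier, knows its incident edges and the number of nodes, has private independent random bits, and in each round may do arbitrary local computation and send one classical message of unbounded size to each neighbour; no shared randomness initially. Total variation distance between $p,q$ on a finite set $X$ is $\frac12\sum_{x}|p(x)-q(x)|$. *)

theory Defs
  imports "HOL-Probability.Probability"
begin

datatype node = V nat | W nat

definition nodes :: "nat \<Rightarrow> node set" where
  "nodes d = {V j | j. j < 3 * d} \<union> {W i | i. i < 3}"

definition edges :: "nat \<Rightarrow> (node \<times> node) set" where
  "edges d =
     {(V j, V ((j + 1) mod (3 * d))) | j. j < 3 * d}
   \<union> {(V ((j + 1) mod (3 * d)), V j) | j. j < 3 * d}
   \<union> {(V (d * i), W i) | i. i < 3}
   \<union> {(W i, V (d * i)) | i. i < 3}"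

definition ball :: "nat \<Rightarrow> nat \<Rightarrow> node \<Rightarrow> node set" where
  "ball d T u = {w. \<exists>k \<le> T. (u, w) \<in> (edges d) ^^ k}"

text \<open>Each node u has an infinite sequence of private independent fair coin flips
  \<open>\<omega> (u, k)\<close>, k = 0, 1, 2, ...\<close>
definition coin_space :: "(node \<times> nat \<Rightarrow> bool) measure" where
  "coin_space = PiM UNIV (\<lambda>_. measure_pmf (bernoulli_pmf (1/2)))"

definition outputs :: "nat \<Rightarrow> (node \<Rightarrow> bool) set" where
  "outputs d = {out. \<forall>u. u \<notin> nodes d \<longrightarrow> \<not> out u}"

definition joint_output :: "nat \<Rightarrow> (node \<Rightarrow> (node \<times> nat \<Rightarrow> bool) \<Rightarrow> bool)
    \<Rightarrow> (node \<times> nat \<Rightarrow> bool) \<Rightarrow> node \<Rightarrow> bool" where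
  "joint_output d f \<omega> = (\<lambda>u. if u \<in> nodes d then f u \<omega> else False)"

definition alg_prob :: "nat \<Rightarrow> (node \<Rightarrow> (node \<times> nat \<Rightarrow> bool) \<Rightarrow> bool)
    \<Rightarrow> (node \<Rightarrow> bool) \<Rightarrow> real" where
  "alg_prob d f out = measure coin_space {\<omega> \<in> space coin_space. joint_output d f \<omega> = out}"

text \<open>A T-round classical LOCAL algorithm on the fixed network \<open>\<G>_d\<close>: the output of node u
  is a (measurable) function of everything in its radius-T ball, i.e. (the graph and the
  identifiers being fixed) of the random bits of the nodes within distance T of u.\<close>
definition local_alg :: "nat \<Rightarrow> nat \<Rightarrow> (node \<Rightarrow> (node \<times> nat \<Rightarrow> bool) \<Rightarrow> bool) \<Rightarrow> bool" where
  "local_alg d T f \<longleftrightarrow>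
     (\<forall>u \<in> nodes d. f u \<in> measurable coin_space (count_space UNIV)) \<and>
     (\<forall>u \<in> nodes d. \<forall>\<omega> \<omega>'. (\<forall>w \<in> ball d T u. \<forall>k. \<omega> (w, k) = \<omega>' (w, k)) \<longrightarrow> f u \<omega> = f u \<omega>')"

text \<open>Computational basis states of n qubits: bit strings x with x j = False for j >= n.\<close>
definition bitstrings :: "nat \<Rightarrow> (nat \<Rightarrow> bool) set" where
  "bitstrings n = {x. \<forall>j \<ge> n. \<not> x j}"

text \<open>Amplitude of |x> in the graph state of the cycle G_d on n = 3d qubits:
  H on every qubit gives 2^(-n/2) sum_x |x>; CZ on each edge {v_j, v_(j+1)} contributes the sign
  (-1)^(x_j x_(j+1)).\<close>
definition graph_state_amp :: "nat \<Rightarrow> (nat \<Rightarrow> bool) \<Rightarrow> complex" where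
  "graph_state_amp d x =
     (-1) ^ card {j. j < 3 * d \<and> x j \<and> x ((j + 1) mod (3 * d))} / sqrt (2 ^ (3 * d))"

text \<open>After applying S^(b_i) = diag(1, i)^(b_i) to the qubit of v_(d i), i = 0,1,2.\<close>
definition phased_amp :: "nat \<Rightarrow> (nat \<Rightarrow> bool) \<Rightarrow> (nat \<Rightarrow> bool) \<Rightarrow> complex" where
  "phased_amp d b x =
     (\<Prod>i<3. if b i \<and> x (d * i) then \<i> else 1) * graph_state_amp d x"

text \<open>After applying H to every qubit: H^(tensor n)|x> = 2^(-n/2) sum_m (-1)^(m.x) |m>.\<close>
definition final_amp :: "nat \<Rightarrow> (nat \<Rightarrow> bool) \<Rightarrow> (nat \<Rightarrow> bool) \<Rightarrow> complex" where
  "final_amp d b m =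
     (\<Sum>x \<in> bitstrings (3 * d). (-1) ^ card {j. j < 3 * d \<and> m j \<and> x j} * phased_amp d b x)
       / sqrt (2 ^ (3 * d))"

definition proc_prob :: "nat \<Rightarrow> (nat \<Rightarrow> bool) \<Rightarrow> (nat \<Rightarrow> bool) \<Rightarrow> real" where
  "proc_prob d b m = (cmod (final_amp d b m))\<^sup>2"

text \<open>\<Gamma_dist>_d: b uniform, w_i outputs b_i, v_j outputs m_j.\<close>
definition Gamma_dist :: "nat \<Rightarrow> (node \<Rightarrow> bool) \<Rightarrow> real" where
  "Gamma_dist d out =
     (if out \<in> outputs d
      then (1/8) * proc_prob d (\<lambda>i. out (W i)) (\<lambda>j. if j < 3 * d then out (V j) else False)
      else 0)"

definition tv_dist :: "('a \<Rightarrow> real) \<Rightarrow> ('a \<Rightarrow> real) \<Rightarrow> 'a set \<Rightarrow> real" where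
  "tv_dist p q X = (1/2) * (\<Sum>x \<in> X. \<bar>p x - q x\<bar>)"

end

theory Submission
  imports Defs
begin

text \<open>Measuring a graph state in X or Y bases obeys parity constraints coming from its stabilisers:
  in the process with bits \<open>b\<close> the outcomes at odd positions always have even parity, those at even
  positions have even parity if \<open>b = 000\<close>, and if exactly two bits are 1, the outcomes at even
  positions together with those at odd positions between the two corresponding nodes have odd
  parity. In \<open>T \<le> d/4\<close> rounds the three leaf outputs are independent and each cycle node is
  correlated with at most one of them, which contradicts these constraints for some \<open>b\<close>, as in
  Mermin's GHZ paradox. Hence, if \<open>q b\<close> is the probability that the algorithm's leaves output \<open>b\<close> and
  \<open>F b\<close> its conditional probability of violating a constraint, then \<open>\<Sum> F b \<ge> 1\<close>. As \<open>\<Gamma>\<^sub>d\<close> gives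
  each \<open>b\<close> mass 1/8 and never violates a constraint, the distance is at least
  \<open>\<Sum> max 0 (1/8 - q b * (1 - F b))\<close>, which is at least 1/11 for all such \<open>q\<close> and \<open>F\<close>.\<close>

section \<open>Parity constraints on the measurement outcomes\<close>

text \<open>The sign (-1)^(a b): the diagonal entry of CZ and, up to the factor 1/sqrt 2, the entry
  of H.\<close>

definition csgn :: "bool \<Rightarrow> bool \<Rightarrow> complex" where
  "csgn a b = (if a \<and> b then -1 else 1)"

definition phase :: "bool \<Rightarrow> bool \<Rightarrow> complex" where
  "phase b x = (if b \<and> x then \<i> else 1)"

text \<open>Contribution of basis state \<open>x\<close> to the amplitude of outcome
  \<open>m\<close>, with both factors 2^(-3d/2) left out.\<close>

definition amp_term :: "nat \<Rightarrow> (nat \<Rightarrow> bool) \<Rightarrow> (nat \<Rightarrow> bool) \<Rightarrow> (nat \<Rightarrow> bool) \<Rightarrow> complex" where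
  "amp_term d b m x = (\<Prod>j<3 * d. csgn (m j) (x j)) *
     ((\<Prod>i<3. phase (b i) (x (d * i))) * (\<Prod>j<3 * d. csgn (x j) (x ((j + 1) mod (3 * d)))))"

lemma neg_one_power_card:
  assumes "finite A"
  shows "(-1::'a::comm_ring_1) ^ card {j \<in> A. P j} = (\<Prod>j\<in>A. if P j then -1 else 1)"
  using assms by (simp add: prod.If_cases Int_def)

lemma neg_one_power_card_lessThan:
  "(-1::complex) ^ card {j::nat. j < n \<and> P j \<and> Q j} = (\<Prod>j<n. csgn (P j) (Q j))"
  using neg_one_power_card[of "{..<n}" "\<lambda>j. P j \<and> Q j", where 'a=complex]
  by (simp add: csgn_def)

section \<open>Fourier analysis on bit strings\<close>

lemma finite_bitstrings: "finite (bitstrings n)"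
  and card_bitstrings: "card (bitstrings n) = 2 ^ n"
proof -
  have b: "bij_betw (\<lambda>x. {j. x j}) (bitstrings n) (Pow {..<n})"
  proof (rule bij_betwI)
    show "(\<lambda>A j. j \<in> A) \<in> Pow {..<n} \<rightarrow> bitstrings n"
      by (force simp: bitstrings_def)
    show "(\<lambda>x. {j. x j}) \<in> bitstrings n \<rightarrow> Pow {..<n}"
      by (auto simp: bitstrings_def) (meson not_le)
  qed auto
  from bij_betw_finite[OF b] show "finite (bitstrings n)" by simp
  from bij_betw_same_card[OF b] show "card (bitstrings n) = 2 ^ n" by (simp add: card_Pow)
qed

text \<open>Distributive law: expanding the product selects a set of positions, read as the bits
  that are 1; the assumption on \<open>g\<close> makes the other factors trivial.\<close>

lemma sum_bitstrings_eq_prod: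
  fixes g :: "nat \<Rightarrow> bool \<Rightarrow> complex"
  assumes "\<And>j. g j False = 1"
  shows "(\<Sum>m\<in>bitstrings n. \<Prod>j<n. g j (m j)) = (\<Prod>j<n. g j True + 1)"
proof -
  have "(\<Prod>j<n. g j True + 1) = (\<Sum>X\<in>Pow {..<n}. \<Prod>j\<in>X. g j True)"
    by (subst prod_add) auto
  also have "\<dots> = (\<Sum>m\<in>bitstrings n. \<Prod>j<n. g j (m j))"
  proof (rule sum.reindex_bij_witness[of _ "\<lambda>x. {j. x j}" "\<lambda>A j. j \<in> A"])
    fix X assume "X \<in> Pow {..<n}"
    then have "{..<n} \<inter> X = X" by auto
    have "(\<Prod>j<n. g j (j \<in> X)) = (\<Prod>j<n. if j \<in> X then g j True else 1)"
      using assms by (intro prod.cong) auto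
    also have "\<dots> = (\<Prod>j\<in>X. g j True)"
      using \<open>{..<n} \<inter> X = X\<close> by (simp add: prod.If_cases)
    finally show "(\<Prod>j<n. g j (j \<in> X)) = (\<Prod>j\<in>X. g j True)" .
    show "(\<lambda>j. j \<in> X) \<in> bitstrings n"
      using \<open>X \<in> Pow {..<n}\<close> by (force simp: bitstrings_def)
  next
    fix x assume "x \<in> bitstrings n"
    then show "{j. x j} \<in> Pow {..<n}"
      by (auto simp: bitstrings_def) (meson not_le)
  qed auto
  finally show ?thesis by simp
qed

text \<open>Characters of (Z/2)^n: the sum factorises over positions, and one where \<open>x\<close>
  and \<open>y\<close> differ gives the factor -1 + 1.\<close>

lemma sum_csgn_orthogonal:
  assumes "x \<in> bitstrings n" "y \<in> bitstrings n"
  shows "(\<Sum>m\<in>bitstrings n. (\<Prod>j<n. csgn (m j) (x j)) * (\<Prod>j<n. csgn (m j) (y j)))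
    = (if x = y then 2 ^ n else 0)"
proof -
  have "(\<Sum>m\<in>bitstrings n. (\<Prod>j<n. csgn (m j) (x j)) * (\<Prod>j<n. csgn (m j) (y j)))
      = (\<Prod>j<n. csgn True (x j) * csgn True (y j) + 1)"
    by (subst sum_bitstrings_eq_prod[of "\<lambda>j m. csgn m (x j) * csgn m (y j)", symmetric])
       (auto simp: csgn_def prod.distrib)
  also have "\<dots> = (if x = y then 2 ^ n else 0)"
  proof (cases "x = y")
    case True
    then have "(\<Prod>j<n. csgn True (x j) * csgn True (y j) + 1) = (\<Prod>j<n. 2::complex)"
      by (intro prod.cong) (auto simp: csgn_def)
    with True show ?thesis by simp
  next
    case False
    then obtain j where "x j \<noteq> y j" by auto
    moreover from this assms have "j < n"
      by (auto simp: bitstrings_def) (metis not_le)+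
    ultimately have "(\<Prod>j<n. csgn True (x j) * csgn True (y j) + 1) = 0"
      by (intro prod_zero) (auto simp: csgn_def intro!: bexI[of _ j])
    with False show ?thesis by simp
  qed
  finally show ?thesis .
qed

text \<open>Unitarity of the final layer of Hadamard gates, which makes the outcome probabilities
  sum to 1.\<close>

lemma parseval_bitstrings:
  fixes \<phi> :: "(nat \<Rightarrow> bool) \<Rightarrow> complex"
  shows "(\<Sum>m\<in>bitstrings n. (cmod (\<Sum>x\<in>bitstrings n. (\<Prod>j<n. csgn (m j) (x j)) * \<phi> x))\<^sup>2)
    = 2 ^ n * (\<Sum>x\<in>bitstrings n. (cmod (\<phi> x))\<^sup>2)"
proof -
  let ?B = "bitstrings n" and ?c = "\<lambda>m x. \<Prod>j<n. csgn (m j) (x j)"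
  have cnj_c: "cnj (?c m x) = ?c m x" for m x :: "nat \<Rightarrow> bool"
    by (simp add: csgn_def if_distrib cong: if_cong)
  have "complex_of_real (\<Sum>m\<in>?B. (cmod (\<Sum>x\<in>?B. ?c m x * \<phi> x))\<^sup>2)
      = (\<Sum>m\<in>?B. (\<Sum>x\<in>?B. ?c m x * \<phi> x) * cnj (\<Sum>y\<in>?B. ?c m y * \<phi> y))"
    by (simp only: of_real_sum complex_norm_square)
  also have "\<dots> = (\<Sum>m\<in>?B. \<Sum>x\<in>?B. \<Sum>y\<in>?B. (?c m x * ?c m y) * (\<phi> x * cnj (\<phi> y)))"
    by (simp only: cnj_sum complex_cnj_mult cnj_c sum_product mult_ac)
  also have "\<dots> = (\<Sum>x\<in>?B. \<Sum>m\<in>?B. \<Sum>y\<in>?B. (?c m x * ?c m y) * (\<phi> x * cnj (\<phi> y)))"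
    by (rule sum.swap)
  also have "\<dots> = (\<Sum>x\<in>?B. \<Sum>y\<in>?B. \<Sum>m\<in>?B. (?c m x * ?c m y) * (\<phi> x * cnj (\<phi> y)))"
    by (rule sum.cong[OF refl], rule sum.swap)
  also have "\<dots> = (\<Sum>x\<in>?B. \<Sum>y\<in>?B. (if x = y then 2 ^ n else 0) * (\<phi> x * cnj (\<phi> y)))"
    by (simp add: sum_csgn_orthogonal flip: sum_distrib_right)
  also have "\<dots> = (\<Sum>x\<in>?B. 2 ^ n * (\<phi> x * cnj (\<phi> x)))"
  proof (rule sum.cong[OF refl])
    fix x assume x: "x \<in> ?B"
    have "(\<Sum>y\<in>?B. (if x = y then 2 ^ n else 0) * (\<phi> x * cnj (\<phi> y)))
        = (\<Sum>y\<in>?B. if x = y then 2 ^ n * (\<phi> x * cnj (\<phi> y)) else 0)"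
      by (intro sum.cong) auto
    then show "(\<Sum>y\<in>?B. (if x = y then 2 ^ n else 0) * (\<phi> x * cnj (\<phi> y)))
        = 2 ^ n * (\<phi> x * cnj (\<phi> x))"
      using x finite_bitstrings by simp
  qed
  also have "\<dots> = complex_of_real (2 ^ n * (\<Sum>x\<in>?B. (cmod (\<phi> x))\<^sup>2))"
    by (simp add: sum_distrib_left flip: complex_norm_square)
  finally show ?thesis
    using of_real_eq_iff by blast
qed

section \<open>Amplitudes in product form and normalisation\<close>

lemma graph_state_amp_eq:
  "graph_state_amp d x = (\<Prod>j<3 * d. csgn (x j) (x ((j + 1) mod (3 * d)))) / sqrt (2 ^ (3 * d))"
  unfolding graph_state_amp_def neg_one_power_card_lessThan[symmetric] by simp

lemma phased_amp_eq:
  "phased_amp d b x = ((\<Prod>i<3. phase (b i) (x (d * i))) *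
     (\<Prod>j<3 * d. csgn (x j) (x ((j + 1) mod (3 * d))))) / sqrt (2 ^ (3 * d))"
  unfolding phased_amp_def graph_state_amp_eq phase_def by simp

lemma final_amp_eq:
  "final_amp d b m = (\<Sum>x\<in>bitstrings (3 * d). amp_term d b m x) / 2 ^ (3 * d)"
proof -
  have "complex_of_real (sqrt (2 ^ (3 * d))) * complex_of_real (sqrt (2 ^ (3 * d))) = 2 ^ (3 * d)"
    by (simp flip: of_real_mult)
  then show ?thesis
    unfolding final_amp_def neg_one_power_card_lessThan phased_amp_eq amp_term_def
    by (simp only: times_divide_eq_right sum_divide_distrib[symmetric] divide_divide_eq_left)
qed

lemma norm_csgn [simp]: "cmod (csgn a b) = 1"
  by (simp add: csgn_def)

lemma norm_phase [simp]: "cmod (phase a b) = 1"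
  by (simp add: phase_def)

lemma sum_proc_prob: "(\<Sum>m\<in>bitstrings (3 * d). proc_prob d b m) = 1"
proof -
  let ?n = "3 * d"
  have n1: "(cmod (phased_amp d b x))\<^sup>2 = 1 / 2 ^ ?n" for x
    unfolding phased_amp_eq
    by (simp add: norm_divide norm_mult power_divide flip: prod_norm)
  have "(\<Sum>m\<in>bitstrings ?n. proc_prob d b m) = (\<Sum>m\<in>bitstrings ?n.
     (cmod (\<Sum>x\<in>bitstrings ?n. (\<Prod>j<?n. csgn (m j) (x j)) * phased_amp d b x))\<^sup>2) / 2 ^ ?n"
    unfolding proc_prob_def final_amp_def neg_one_power_card_lessThan
    by (simp add: norm_divide power_divide flip: sum_divide_distrib)
  also have "\<dots> = 1"
    unfolding parseval_bitstrings n1 by (simp add: card_bitstrings)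
  finally show ?thesis .
qed

section \<open>Symmetries from stabilisers\<close>

lemma csgn_xor_left: "csgn (a \<noteq> a') b = csgn a b * csgn a' b"
  and csgn_xor_right: "csgn a (b \<noteq> b') = csgn a b * csgn a b'"
  and csgn_commute: "csgn a b = csgn b a"
  and csgn_False [simp]: "csgn False b = 1"
  and csgn_square: "csgn a b * csgn a b = 1"
  by (auto simp: csgn_def)

lemma phase_xor:
  "phase b (x \<noteq> s) = phase b x * (phase b s * csgn (b \<and> s) x)"
  by (auto simp: phase_def csgn_def)

lemma mod_Suc_pred:
  assumes "j < (n::nat)"
  shows "((j + 1) mod n + n - 1) mod n = j" and "((j + n - 1) mod n + 1) mod n = j"
proof -
  show "((j + 1) mod n + n - 1) mod n = j"
    using assms by (cases "j + 1 = n") auto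
  show "((j + n - 1) mod n + 1) mod n = j"
    using assms by (cases "j = 0") (auto simp: mod_if)
qed

lemma bij_betw_mod_Suc:
  assumes "0 < (n::nat)"
  shows "bij_betw (\<lambda>j. (j + 1) mod n) {..<n} {..<n}"
  using assms mod_Suc_pred by (intro bij_betwI[where g="\<lambda>j. (j + n - 1) mod n"]) auto

text \<open>The phase of a summand is quadratic in \<open>x\<close>, so shifting by \<open>s\<close>
  yields a constant and cross terms linear in \<open>x\<close>. CZ produces a cross term at nodes
  with exactly one neighbour in \<open>s\<close>, S at anchors in \<open>s\<close> with bit 1; by
  \<open>stab\<close> these are the same nodes, so the terms cancel.\<close>

lemma amp_term_xor:
  assumes d: "0 < d"
    and stab: "\<And>j. j < 3 * d \<Longrightarrow> (s ((j + 3 * d - 1) mod (3 * d)) \<noteq> s ((j + 1) mod (3 * d)))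
       = (\<exists>i<3. j = d * i \<and> b i \<and> s j)"
  shows "amp_term d b m (\<lambda>j. x j \<noteq> s j) =
    ((\<Prod>j<3 * d. csgn (m j) (s j)) * (\<Prod>j<3 * d. csgn (s j) (s ((j + 1) mod (3 * d))))
      * (\<Prod>i<3. phase (b i) (s (d * i)))) * amp_term d b m x"
proof -
  let ?n = "3 * d"
  let ?t = "\<lambda>j. s ((j + ?n - 1) mod ?n) \<noteq> s ((j + 1) mod ?n)"
  have n: "0 < ?n" using d by simp
  have A: "(\<Prod>j<?n. csgn (s j) (x ((j + 1) mod ?n)))
     = (\<Prod>j<?n. csgn (s ((j + ?n - 1) mod ?n)) (x j))"
    using mod_Suc_pred(1)
    by (subst prod.reindex_bij_betw[OF bij_betw_mod_Suc[OF n], symmetric])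
       (auto intro!: prod.cong)
  \<comment> \<open>\<open>?t j\<close> holds if exactly one neighbour of \<open>j\<close> lies in
    \<open>s\<close>.\<close>
  have B: "(\<Prod>j<?n. csgn (?t j) (x j)) = (\<Prod>i<3. csgn (b i \<and> s (d * i)) (x (d * i)))"
  proof -
    have "(\<Prod>j<?n. csgn (?t j) (x j)) = (\<Prod>j\<in>(\<lambda>i. d * i) ` {..<3}. csgn (?t j) (x j))"
    proof (rule prod.mono_neutral_right)
      show "\<forall>j\<in>{..<?n} - (\<lambda>i. d * i) ` {..<3}. csgn (?t j) (x j) = 1"
      proof
        fix j assume "j \<in> {..<?n} - (\<lambda>i. d * i) ` {..<3}"
        then have "\<not> ?t j" using stab[of j] by auto
        then show "csgn (?t j) (x j) = 1" by (simp only: csgn_False)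
      qed
    qed (use d in auto)
    also have "\<dots> = (\<Prod>i<3. csgn (?t (d * i)) (x (d * i)))"
      using d by (subst prod.reindex) (auto simp: inj_on_def)
    also have "\<dots> = (\<Prod>i<3. csgn (b i \<and> s (d * i)) (x (d * i)))"
    proof (rule prod.cong[OF refl])
      fix i :: nat assume "i \<in> {..<3}"
      then have "d * i < ?n" and "(\<exists>k<3. d * i = d * k \<and> b k \<and> s (d * i)) = (b i \<and> s (d * i))"
        using d by auto
      with stab[of "d * i"] show "csgn (?t (d * i)) (x (d * i)) = csgn (b i \<and> s (d * i)) (x (d * i))"
        by simp
    qed
    finally show ?thesis .
  qed
  have C: "(\<Prod>j<?n. csgn (x j \<noteq> s j) (x ((j + 1) mod ?n) \<noteq> s ((j + 1) mod ?n)))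
     = (\<Prod>j<?n. csgn (x j) (x ((j + 1) mod ?n))) * (\<Prod>j<?n. csgn (?t j) (x j))
       * (\<Prod>j<?n. csgn (s j) (s ((j + 1) mod ?n)))"
    unfolding csgn_xor_left csgn_xor_right prod.distrib A
    by (simp add: mult_ac csgn_commute)
  have D: "(\<Prod>i<3. phase (b i) (x (d * i) \<noteq> s (d * i)))
     = (\<Prod>i<3. phase (b i) (x (d * i))) * (\<Prod>i<3. phase (b i) (s (d * i)))
       * (\<Prod>i<3. csgn (b i \<and> s (d * i)) (x (d * i)))"
    unfolding phase_xor prod.distrib by (simp add: mult_ac)
  \<comment> \<open>The cross terms of CZ and of S coincide and, being signs, multiply to 1.\<close>
  have E: "(\<Prod>i<3. csgn (b i \<and> s (d * i)) (x (d * i))) * (\<Prod>i<3. csgn (b i \<and> s (d * i)) (x (d * i))) = 1"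
    unfolding prod.distrib[symmetric] by (simp add: csgn_square)
  have F: "(p * q) * ((h * u * v) * (f * v * w)) = (q * w * u) * (p * (h * f))"
    if "v * v = 1" for p q h u v f w :: complex
  proof -
    have "(p * q) * ((h * u * v) * (f * v * w)) = (q * w * u) * (p * (h * f)) * (v * v)"
      by (simp add: mult_ac)
    with that show ?thesis by simp
  qed
  show ?thesis
    unfolding amp_term_def C D B csgn_xor_right[of "m _"] prod.distrib
    by (rule F[OF E])
qed

text \<open>The set where \<open>s\<close> holds names a product of stabilisers of the graph state. Flipping the
  summation variable along \<open>s\<close> scales every summand by the same constant, the eigenvalue of that
  product times the sign of the outcome.\<close>

lemma final_amp_eq_0:
  assumes d: "0 < d"
    and s: "s \<in> bitstrings (3 * d)"
    and stab: "\<And>j. j < 3 * d \<Longrightarrow> (s ((j + 3 * d - 1) mod (3 * d)) \<noteq> s ((j + 1) mod (3 * d)))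
       = (\<exists>i<3. j = d * i \<and> b i \<and> s j)"
    and ne: "(\<Prod>j<3 * d. csgn (m j) (s j)) * (\<Prod>j<3 * d. csgn (s j) (s ((j + 1) mod (3 * d))))
      * (\<Prod>i<3. phase (b i) (s (d * i))) \<noteq> 1" (is "?\<kappa> \<noteq> 1")
  shows "final_amp d b m = 0"
proof -
  let ?B = "bitstrings (3 * d)"
  have "(\<Sum>x\<in>?B. amp_term d b m x) = (\<Sum>x\<in>?B. amp_term d b m (\<lambda>j. x j \<noteq> s j))"
  proof (rule sum.reindex_bij_witness[of _ "\<lambda>x j. x j \<noteq> s j" "\<lambda>x j. x j \<noteq> s j"])
    fix x :: "nat \<Rightarrow> bool"
    have "(\<lambda>j. (x j \<noteq> s j) \<noteq> s j) = x" by auto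
    then show "amp_term d b m (\<lambda>j. (x j \<noteq> s j) \<noteq> s j) = amp_term d b m x" by simp
  qed (use s in \<open>auto simp: bitstrings_def\<close>)
  also have "\<dots> = ?\<kappa> * (\<Sum>x\<in>?B. amp_term d b m x)"
    unfolding sum_distrib_left by (intro sum.cong refl amp_term_xor d stab)
  finally have "(\<Sum>x\<in>?B. amp_term d b m x) = 0"
    using ne by (simp add: mult_cancel_right1)
  then show ?thesis by (simp add: final_amp_eq)
qed

section \<open>The three parity constraints\<close>

lemma final_amp_odd_parity:
  assumes d: "0 < d" "even d" and nz: "final_amp d b m \<noteq> 0"
  shows "even (card {j. j < 3 * d \<and> m j \<and> odd j})"
proof (rule ccontr)
  assume o: "odd (card {j. j < 3 * d \<and> m j \<and> odd j})"
  \<comment> \<open>Every even node has both neighbours in \<open>s\<close>, and no edge lies inside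
    \<open>s\<close>. As \<open>d\<close> is even, the S gates sit outside \<open>s\<close>, so
    \<open>b\<close> is arbitrary.\<close>
  define s where "s = (\<lambda>j. odd j \<and> j < 3 * d)"
  have ev: "even (j mod (3 * d)) = even j" for j
    using d by (simp add: dvd_mod_iff)
  have sm: "s (j mod (3 * d)) = odd j" for j
    using d by (simp add: s_def ev)
  have "final_amp d b m = 0"
  proof (rule final_amp_eq_0[of d s])
    show "s \<in> bitstrings (3 * d)" by (auto simp: s_def bitstrings_def)
    show "(s ((j + 3 * d - 1) mod (3 * d)) \<noteq> s ((j + 1) mod (3 * d)))
       = (\<exists>i<3. j = d * i \<and> b i \<and> s j)" for j
      using d unfolding sm by (auto simp: s_def)
    have 1: "(\<Prod>j<3 * d. csgn (m j) (s j)) = -1"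
    proof -
      have "{j. j < 3 * d \<and> m j \<and> s j} = {j. j < 3 * d \<and> m j \<and> odd j}" by (auto simp: s_def)
      with o show ?thesis unfolding neg_one_power_card_lessThan[symmetric] by simp
    qed
    have 2: "(\<Prod>j<3 * d. csgn (s j) (s ((j + 1) mod (3 * d)))) = 1"
      unfolding sm by (intro prod.neutral) (auto simp: s_def csgn_def)
    have 3: "(\<Prod>i<3. phase (b i) (s (d * i))) = 1"
      using d by (intro prod.neutral) (auto simp: s_def phase_def)
    show "(\<Prod>j<3 * d. csgn (m j) (s j)) * (\<Prod>j<3 * d. csgn (s j) (s ((j + 1) mod (3 * d))))
      * (\<Prod>i<3. phase (b i) (s (d * i))) \<noteq> 1"
      unfolding 1 2 3 by simp
  qed (use d in auto)
  with nz show False by simp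
qed

lemma final_amp_even_parity:
  assumes d: "0 < d" "even d" and nz: "final_amp d b m \<noteq> 0" and b: "\<And>i. i < 3 \<Longrightarrow> \<not> b i"
  shows "even (card {j. j < 3 * d \<and> m j \<and> even j})"
proof (rule ccontr)
  assume o: "odd (card {j. j < 3 * d \<and> m j \<and> even j})"
  define s where "s = (\<lambda>j. even j \<and> j < 3 * d)"
  have ev: "even (j mod (3 * d)) = even j" for j
    using d by (simp add: dvd_mod_iff)
  have sm: "s (j mod (3 * d)) = even j" for j
    using d by (simp add: s_def ev)
  have "final_amp d b m = 0"
  proof (rule final_amp_eq_0[of d s])
    show "s \<in> bitstrings (3 * d)" by (auto simp: s_def bitstrings_def)
    show "(s ((j + 3 * d - 1) mod (3 * d)) \<noteq> s ((j + 1) mod (3 * d)))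
       = (\<exists>i<3. j = d * i \<and> b i \<and> s j)" for j
      using d b unfolding sm by (auto simp: s_def)
    have 1: "(\<Prod>j<3 * d. csgn (m j) (s j)) = -1"
    proof -
      have "{j. j < 3 * d \<and> m j \<and> s j} = {j. j < 3 * d \<and> m j \<and> even j}" by (auto simp: s_def)
      with o show ?thesis unfolding neg_one_power_card_lessThan[symmetric] by simp
    qed
    have 2: "(\<Prod>j<3 * d. csgn (s j) (s ((j + 1) mod (3 * d)))) = 1"
      unfolding sm by (intro prod.neutral) (auto simp: s_def csgn_def)
    have 3: "(\<Prod>i<3. phase (b i) (s (d * i))) = 1"
      using b by (intro prod.neutral) (auto simp: phase_def)
    show "(\<Prod>j<3 * d. csgn (m j) (s j)) * (\<Prod>j<3 * d. csgn (s j) (s ((j + 1) mod (3 * d))))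
      * (\<Prod>i<3. phase (b i) (s (d * i))) \<noteq> 1"
      unfolding 1 2 3 by simp
  qed (use d in auto)
  with nz show False by simp
qed

lemma prod_lessThan_3: "(\<Prod>i<(3::nat). f i) = (f 0 * f 1 * f 2 :: 'a::comm_monoid_mult)"
  by (simp add: numeral_3_eq_3 numeral_2_eq_2 lessThan_Suc mult_ac)

text \<open>Segment \<open>k\<close> is added to the even nodes. Each of its two end anchors then
  has exactly one neighbour in the set, which the S gate there compensates; the two factors i make
  the eigenvalue -1.\<close>

lemma final_amp_segment_parity:
  assumes d: "0 < d" "even d" and nz: "final_amp d b m \<noteq> 0" and k: "k < 3"
    and b: "\<And>i. i < 3 \<Longrightarrow> b i = (i = k \<or> i = (k + 1) mod 3)"
  shows "odd (card {j. j < 3 * d \<and> m j \<and> (even j \<or> j div d = k)})"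
proof (rule ccontr)
  assume "\<not> odd (card {j. j < 3 * d \<and> m j \<and> (even j \<or> j div d = k)})"
  then have o: "even (card {j. j < 3 * d \<and> m j \<and> (even j \<or> j div d = k)})" by simp
  define s where "s = (\<lambda>j. (even j \<or> j div d = k) \<and> j < 3 * d)"
  have ev: "even (j mod (3 * d)) = even j" for j
    using d by (simp add: dvd_mod_iff)
  have sm: "s (j mod (3 * d)) = (even j \<or> (j mod (3 * d)) div d = k)" for j
    using d by (simp add: s_def ev)
  \<comment> \<open>As \<open>d\<close> is even, the last position of a segment is odd, so the
    successor of an even \<open>j\<close> stays in its segment.\<close>
  have up: "((j + 1) mod (3 * d)) div d = j div d" if "even j" "j < 3 * d" for j
  proof -
    have "j + 1 < 3 * d" using that d
      by (metis Suc_eq_plus1 Suc_lessI even_Suc even_mult_iff)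
    moreover have "(j + 1) div d = j div d"
    proof -
      have "\<not> d dvd Suc j" using that d by (meson dvd_trans even_Suc)
      then show ?thesis by (simp add: div_Suc dvd_eq_mod_eq_0)
    qed
    ultimately show ?thesis by simp
  qed
  have "final_amp d b m = 0"
  proof (rule final_amp_eq_0[of d s])
    show "s \<in> bitstrings (3 * d)" by (auto simp: s_def bitstrings_def)
    show "(s ((j + 3 * d - 1) mod (3 * d)) \<noteq> s ((j + 1) mod (3 * d)))
       = (\<exists>i<3. j = d * i \<and> b i \<and> s j)" if j: "j < 3 * d" for j
    proof (cases "even j")
      case False
      then have "\<And>i. j \<noteq> d * i" using d by auto
      with False show ?thesis using d unfolding sm by auto
    next
      case True
      define i r where "i = j div d" and "r = j mod d"
      have jir: "j = d * i + r" and r: "r < d" and i: "i < 3"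
        using d j by (auto simp: i_def r_def less_mult_imp_div_less mult.commute)
      \<comment> \<open>Both neighbours of an even \<open>j\<close> are odd, hence in
        \<open>s\<close> only if they lie in segment \<open>k\<close>; the right one shares the
        segment of \<open>j\<close>.\<close>
      have lhs: "(s ((j + 3 * d - 1) mod (3 * d)) \<noteq> s ((j + 1) mod (3 * d)))
          = ((((j + 3 * d - 1) mod (3 * d)) div d = k) \<noteq> (i = k))"
        using True d j unfolding sm up[OF True j] i_def[symmetric] by auto
      show ?thesis
      proof (cases "r = 0")
        case False
        then have "(j + 3 * d - 1) mod (3 * d) = d * i + (r - 1)"
          using j jir by (simp add: mod_if)
        then have "((j + 3 * d - 1) mod (3 * d)) div d = i"
          using r d by simp
        moreover have "j \<noteq> d * i'" for i'
        proof
          assume "j = d * i'"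
          then have "r = 0" by (simp add: r_def)
          with False show False by simp
        qed
        ultimately show ?thesis unfolding lhs by auto
      next
        case r0: True
        \<comment> \<open>At an anchor the left neighbour is in the cyclically preceding
          segment.\<close>
        have prev: "((j + 3 * d - 1) mod (3 * d)) div d = (i + 2) mod 3"
        proof (cases "i = 0")
          case True
          have "(3 * d - 1) div d = 2"
            using d by (intro div_nat_eqI) auto
          with True r0 jir d show ?thesis by simp
        next
          case False
          then obtain i' where i': "i = Suc i'" by (cases i) auto
          have "j + 3 * d - 1 = (d * i' + (d - 1)) + 3 * d"
            using jir r0 i' d by simp
          then have "(j + 3 * d - 1) mod (3 * d) = (d * i' + (d - 1)) mod (3 * d)"
            by simp
          also have "\<dots> = d * i' + (d - 1)"
          proof (rule mod_less)
            have "d * i' + (d - 1) < j" using jir r0 i' d by simp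
            with j show "d * i' + (d - 1) < 3 * d" by simp
          qed
          finally have "((j + 3 * d - 1) mod (3 * d)) div d = i'"
            using div_nat_eqI[of d i' "d * i' + (d - 1)"] d by (simp only:) simp
          moreover have "(i + 2) mod 3 = i'" using i i' by simp
          ultimately show ?thesis by simp
        qed
        have "(\<exists>i'<3. j = d * i' \<and> b i' \<and> s j) = b i"
          using jir r0 d i True j by (auto simp: s_def)
        moreover have "b i = (((i + 2) mod 3 = k) \<noteq> (i = k))"
        proof -
          have "i = 0 \<or> i = 1 \<or> i = 2" "k = 0 \<or> k = 1 \<or> k = 2" using i k by auto
          then show ?thesis unfolding b[OF i] by (elim disjE) simp_all
        qed
        ultimately show ?thesis unfolding lhs prev by simp
      qed
    qed
    have 1: "(\<Prod>j<3 * d. csgn (m j) (s j)) = 1"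
    proof -
      have "{j. j < 3 * d \<and> m j \<and> s j} = {j. j < 3 * d \<and> m j \<and> (even j \<or> j div d = k)}"
        by (auto simp: s_def)
      with o show ?thesis unfolding neg_one_power_card_lessThan[symmetric] by simp
    qed
    have 2: "(\<Prod>j<3 * d. csgn (s j) (s ((j + 1) mod (3 * d)))) = 1"
    proof -
      \<comment> \<open>The edges inside \<open>s\<close> are those starting in segment
        \<open>k\<close>: there are \<open>d\<close>, an even number.\<close>
      have "(s j \<and> s ((j + 1) mod (3 * d))) = (j div d = k)" if "j < 3 * d" for j
        using up[OF _ that] that unfolding sm by (cases "even j") (auto simp: s_def)
      then have "{j. j < 3 * d \<and> s j \<and> s ((j + 1) mod (3 * d))} = {j. j < 3 * d \<and> j div d = k}"
        by blast
      also have "\<dots> = {d * k..<d * k + d}"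
      proof -
        have "d * k \<le> j \<and> j < d * k + d" if "j div d = k" for j
          unfolding that[symmetric]
          using mult_div_mod_eq[of d j] mod_less_divisor[OF d(1), of j] by (intro conjI) linarith+
        moreover have "j div d = k" if "d * k \<le> j" "j < d * k + d" for j
          using that by (intro div_nat_eqI) auto
        moreover have "d * k + d \<le> 3 * d"
          using k mult_le_mono2[of "k + 1" 3 d] by (simp add: algebra_simps)
        then have "j < 3 * d" if "j < d * k + d" for j
          using that by linarith
        ultimately show ?thesis by (intro set_eqI) (simp, blast)
      qed
      finally show ?thesis unfolding neg_one_power_card_lessThan[symmetric] using d by simp
    qed
    have 3: "(\<Prod>i<3. phase (b i) (s (d * i))) = -1"
    proof -
      have "s (d * i)" if "i < 3" for i
        using that d by (simp add: s_def)
      then have "(\<Prod>i<3. phase (b i) (s (d * i)))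
          = (\<Prod>i<3. if i = k \<or> i = (k + 1) mod 3 then \<i> else 1)"
        using b by (intro prod.cong) (simp_all add: phase_def)
      moreover consider "k = 0" | "k = 1" | "k = 2" using k by linarith
      then have "(\<Prod>i<3. if i = k \<or> i = (k + 1) mod 3 then \<i> else 1) = - 1"
        by cases (simp_all add: prod_lessThan_3)
      ultimately show ?thesis by (rule trans)
    qed
    show "(\<Prod>j<3 * d. csgn (m j) (s j)) * (\<Prod>j<3 * d. csgn (s j) (s ((j + 1) mod (3 * d))))
      * (\<Prod>i<3. phase (b i) (s (d * i))) \<noteq> 1"
      unfolding 1 2 3 by simp
  qed (use d in auto)
  with nz show False by simp
qed

section \<open>Two independent copies of the coins\<close>

lemma prob_space_coin_space: "prob_space coin_space"
  unfolding coin_space_def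
  by (intro prob_space_PiM prob_space_measure_pmf)

lemma space_coin_space [simp]: "space coin_space = UNIV"
  by (simp add: coin_space_def space_PiM)

text \<open>Both copies form one family indexed by coin and copy, so exchanging them at some nodes
  permutes the indices.\<close>

definition double_coins :: "((node \<times> nat) \<times> bool \<Rightarrow> bool) measure" where
  "double_coins = PiM UNIV (\<lambda>_. measure_pmf (bernoulli_pmf (1/2)))"

lemma prob_space_double_coins: "prob_space double_coins"
  unfolding double_coins_def
  by (intro prob_space_PiM prob_space_measure_pmf)

lemma space_double_coins [simp]: "space double_coins = UNIV"
  by (simp add: double_coins_def space_PiM)

definition copy :: "bool \<Rightarrow> ((node \<times> nat) \<times> bool \<Rightarrow> bool) \<Rightarrow> node \<times> nat \<Rightarrow> bool" where
  "copy c \<Omega> = (\<lambda>i. \<Omega> (i, c))"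

definition swap_copies :: "node set \<Rightarrow> ((node \<times> nat) \<times> bool \<Rightarrow> bool) \<Rightarrow> (node \<times> nat) \<times> bool \<Rightarrow> bool" where
  "swap_copies J \<Omega> = (\<lambda>(i, c). \<Omega> (i, c \<noteq> (fst i \<in> J)))"

lemma copy_swap_copies:
  "copy c (swap_copies J \<Omega>) = (\<lambda>i. if fst i \<in> J then copy (\<not> c) \<Omega> i else copy c \<Omega> i)"
  by (rule ext) (auto simp: copy_def swap_copies_def)

lemma distr_PiM_UNIV_reindex:
  assumes "prob_space M" "inj f"
  shows "distr (PiM UNIV (\<lambda>_. M)) (PiM UNIV (\<lambda>_. M)) (\<lambda>\<omega> n. \<omega> (f n)) = PiM UNIV (\<lambda>_. M)"
  using distr_PiM_reindex[of UNIV "\<lambda>_. M" f UNIV] assms by (simp add: restrict_UNIV)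

lemma distr_copy: "distr double_coins coin_space (copy c) = coin_space"
  unfolding double_coins_def coin_space_def copy_def
  using distr_PiM_reindex[of UNIV "\<lambda>_. measure_pmf (bernoulli_pmf (1/2))" "\<lambda>i. (i, c)" UNIV]
  by (simp add: restrict_UNIV inj_on_def prob_space_measure_pmf)

text \<open>An i.i.d. family keeps its law under an injective renaming of indices.\<close>

lemma distr_swap_copies: "distr double_coins double_coins (swap_copies J) = double_coins"
proof -
  have "inj (\<lambda>k :: (node \<times> nat) \<times> bool. (fst k, snd k \<noteq> (fst (fst k) \<in> J)))"
    by (rule injI) (simp add: prod_eq_iff, metis)
  from distr_PiM_UNIV_reindex[OF prob_space_measure_pmf this] show ?thesis
    unfolding double_coins_def swap_copies_def case_prod_unfold .
qed

lemma measurable_copy [measurable]: "copy c \<in> measurable double_coins coin_space"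
  unfolding double_coins_def coin_space_def copy_def
  by (rule measurable_PiM_single') (auto simp: space_PiM)

lemma measurable_swap_copies [measurable]: "swap_copies J \<in> measurable double_coins double_coins"
  unfolding double_coins_def swap_copies_def case_prod_unfold
  by (rule measurable_PiM_single') (auto simp: space_PiM)

text \<open>The copies read disjoint blocks of coordinates of a product measure.\<close>

lemma indep_copies:
  "prob_space.indep_var double_coins coin_space (copy False) coin_space (copy True)"
proof -
  interpret prob_space double_coins by (rule prob_space_double_coins)
  let ?p = "measure_pmf (bernoulli_pmf (1/2))"
  have "indep_vars (\<lambda>_. ?p) (\<lambda>i \<Omega>. \<Omega> i) UNIV"
  proof (subst indep_vars_iff_distr_eq_PiM')
    have "distr double_coins ?p (\<lambda>\<Omega>. \<Omega> i) = ?p" for i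
      unfolding double_coins_def by (rule distr_PiM_component) (auto simp: prob_space_measure_pmf)
    then show "distr double_coins (PiM UNIV (\<lambda>_. ?p)) (\<lambda>\<Omega>. \<lambda>i\<in>UNIV. \<Omega> i)
        = PiM UNIV (\<lambda>i. distr double_coins ?p (\<lambda>\<Omega>. \<Omega> i))"
      by (simp add: restrict_UNIV) (simp add: double_coins_def)
  qed (auto simp: double_coins_def)
  then have *: "indep_var (PiM (UNIV \<times> {False}) (\<lambda>_. ?p)) (\<lambda>\<Omega>. restrict (\<lambda>i. \<Omega> i) (UNIV \<times> {False}))
     (PiM (UNIV \<times> {True}) (\<lambda>_. ?p)) (\<lambda>\<Omega>. restrict (\<lambda>i. \<Omega> i) (UNIV \<times> {True}))"
    by (rule indep_var_restrict) auto
  have m: "(\<lambda>\<Omega> i. \<Omega> (i, c)) \<in> measurable (PiM (UNIV \<times> {c}) (\<lambda>_. ?p)) coin_space" for c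
    unfolding coin_space_def by (rule measurable_PiM_single') (auto simp: space_PiM)
  have "(\<lambda>\<Omega> i. \<Omega> (i, c)) \<circ> (\<lambda>\<Omega>. restrict (\<lambda>i. \<Omega> i) (UNIV \<times> {c})) = copy c" for c
    by (auto simp: copy_def)
  with indep_var_compose[OF * m[of False] m[of True]] show ?thesis by (simp only:)
qed

lemma measure_copies:
  assumes "A \<in> sets coin_space" "B \<in> sets coin_space"
  shows "measure double_coins {\<Omega>. copy False \<Omega> \<in> A \<and> copy True \<Omega> \<in> B}
     = measure coin_space A * measure coin_space B"
proof -
  interpret prob_space double_coins by (rule prob_space_double_coins)
  have c: "measure double_coins (copy c -` X \<inter> space double_coins) = measure coin_space X"
    if "X \<in> sets coin_space" for c X
    using measure_distr[OF measurable_copy that, of c] by (simp add: distr_copy)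
  have "{\<Omega>. copy False \<Omega> \<in> A \<and> copy True \<Omega> \<in> B}
      = (\<lambda>\<Omega>. (copy False \<Omega>, copy True \<Omega>)) -` (A \<times> B) \<inter> space double_coins"
    by auto
  then show ?thesis
    by (simp only: indep_varD[OF indep_copies assms] c[OF assms(1)] c[OF assms(2)])
qed

lemma measure_swap_copies:
  assumes "A \<in> sets double_coins"
  shows "measure double_coins {\<Omega>. swap_copies J \<Omega> \<in> A} = measure double_coins A"
  using measure_distr[OF measurable_swap_copies assms, of J]
  by (simp add: distr_swap_copies vimage_def)

section \<open>Locality and the parity contradiction\<close>

text \<open>The only \<open>i\<close> for which the bit of leaf \<open>W i\<close> can influence the output of \<open>V j\<close>. The two
  half-segments adjacent to \<open>V 0\<close> lie at both ends of the index range.\<close>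

definition anchor :: "nat \<Rightarrow> nat \<Rightarrow> nat" where
  "anchor d j = (if j < d div 2 \<or> 5 * (d div 2) \<le> j then 0 else if j < 3 * (d div 2) then 1 else 2)"

section \<open>Distances from the leaves\<close>

definition cycle_dist :: "nat \<Rightarrow> nat \<Rightarrow> nat \<Rightarrow> nat" where
  "cycle_dist n a b = min (max a b - min a b) (n - (max a b - min a b))"

text \<open>Closed form of the graph distance from \<open>W i\<close>. It changes by at most 1 along
  an edge, which bounds path lengths from below.\<close>

definition leaf_dist :: "nat \<Rightarrow> nat \<Rightarrow> node \<Rightarrow> nat" where
  "leaf_dist d i u = (case u of V j \<Rightarrow> cycle_dist (3 * d) (d * i) j + 1
     | W k \<Rightarrow> if k = i then 0 else cycle_dist (3 * d) (d * i) (d * k) + 2)"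

lemma cycle_dist_Suc_mod:
  assumes "a < n" "c < n"
  shows "cycle_dist n c ((a + 1) mod n) \<le> cycle_dist n c a + 1"
    and "cycle_dist n c a \<le> cycle_dist n c ((a + 1) mod n) + 1"
proof -
  have "cycle_dist n c ((a + 1) mod n) \<le> cycle_dist n c a + 1 \<and>
    cycle_dist n c a \<le> cycle_dist n c ((a + 1) mod n) + 1"
  proof (cases "a + 1 = n")
    case True
    then have "(a + 1) mod n = 0" by simp
    with True assms show ?thesis by (simp only:) (auto simp: cycle_dist_def min_def max_def)
  next
    case False
    with assms have "(a + 1) mod n = a + 1" by simp
    with False assms show ?thesis by (simp only:) (auto simp: cycle_dist_def min_def max_def)
  qed
  then show "cycle_dist n c ((a + 1) mod n) \<le> cycle_dist n c a + 1"
    and "cycle_dist n c a \<le> cycle_dist n c ((a + 1) mod n) + 1" by auto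
qed

lemma leaf_dist_edge:
  assumes "(u, w) \<in> edges d" "i < 3"
  shows "leaf_dist d i u \<le> leaf_dist d i w + 1" "leaf_dist d i w \<le> leaf_dist d i u + 1"
proof -
  have "leaf_dist d i u \<le> leaf_dist d i w + 1 \<and> leaf_dist d i w \<le> leaf_dist d i u + 1"
    using assms(1) unfolding edges_def
  proof (elim UnE CollectE exE conjE)
    fix j assume uw: "(u, w) = (V j, V ((j + 1) mod (3 * d)))" and j: "j < 3 * d"
    then have "d * i < 3 * d" using mult_less_mono2[OF assms(2), of d] by linarith
    from cycle_dist_Suc_mod[OF j this] uw show ?thesis by (simp add: leaf_dist_def)
  next
    fix j assume uw: "(u, w) = (V ((j + 1) mod (3 * d)), V j)" and j: "j < 3 * d"
    then have "d * i < 3 * d" using mult_less_mono2[OF assms(2), of d] by linarith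
    from cycle_dist_Suc_mod[OF j this] uw show ?thesis by (simp add: leaf_dist_def)
  qed (auto simp: leaf_dist_def cycle_dist_def)
  then show "leaf_dist d i u \<le> leaf_dist d i w + 1" "leaf_dist d i w \<le> leaf_dist d i u + 1"
    by auto
qed

lemma leaf_dist_relpow:
  assumes "(u, w) \<in> edges d ^^ k" "i < 3"
  shows "leaf_dist d i u \<le> leaf_dist d i w + k \<and> leaf_dist d i w \<le> leaf_dist d i u + k"
  using assms(1)
proof (induction k arbitrary: w)
  case (Suc k)
  then obtain z where z: "(u, z) \<in> edges d ^^ k" "(z, w) \<in> edges d" by auto
  from Suc.IH[OF z(1)] leaf_dist_edge[OF z(2) assms(2)] show ?case by linarith
qed simp

lemma leaf_dist_balls:
  assumes "x \<in> ball d T u" "x \<in> ball d T (W i)" "i < 3"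
  shows "leaf_dist d i u \<le> 2 * T"
proof -
  obtain k where k: "k \<le> T" "(u, x) \<in> edges d ^^ k"
    using assms(1) unfolding ball_def by blast
  obtain l where l: "l \<le> T" "(W i, x) \<in> edges d ^^ l"
    using assms(2) unfolding ball_def by blast
  have "leaf_dist d i (W i) = 0" by (simp add: leaf_dist_def)
  with leaf_dist_relpow[OF k(2) assms(3)] leaf_dist_relpow[OF l(2) assms(3)] k(1) l(1)
  show ?thesis by linarith
qed

text \<open>Distinct leaves are at distance at least d + 2, but intersecting balls would put them
  within 2T \<le> d/2.\<close>

lemma leaf_balls_disjoint:
  assumes "x \<in> ball d T (W k)" "x \<in> ball d T (W i)" "k < 3" "i < 3" "4 * T \<le> d"
  shows "k = i"
proof (rule ccontr)
  assume ne: "k \<noteq> i"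
  have "i \<in> {0, 1, 2}" "k \<in> {0, 1, 2}" using assms(3,4) by auto
  with ne have "d \<le> cycle_dist (3 * d) (d * i) (d * k)"
    by (auto simp: cycle_dist_def)
  with leaf_dist_balls[OF assms(1,2,4)] ne assms(5) show False
    by (simp add: leaf_dist_def)
qed

text \<open>Intersecting balls put \<open>V j\<close> within 2T \<le> d/2 of the leaf. The pendant
  edge uses one step, so the distance along the cycle is strictly below d/2, which settles the
  midpoints between anchors.\<close>

lemma cycle_leaf_balls:
  assumes "x \<in> ball d T (V j)" "x \<in> ball d T (W i)" "j < 3 * d" "i < 3" "4 * T \<le> d" "even d"
  shows "i = anchor d j"
proof -
  obtain h where h: "d = 2 * h" using assms(6) by auto
  have "cycle_dist (3 * d) (d * i) j + 1 \<le> h"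
    using leaf_dist_balls[OF assms(1,2,4)] assms(5) h by (simp add: leaf_dist_def)
  moreover have "i \<in> {0, 1, 2}" using assms(4) by auto
  ultimately show ?thesis
    using assms(3) by (auto simp: anchor_def cycle_dist_def h min_def max_def split: if_splits)
qed

lemma anchor_segment:
  assumes "j < 3 * d" "even d"
  shows "anchor d j = j div d \<or> anchor d j = (j div d + 1) mod 3"
proof -
  obtain h where h: "d = 2 * h" using assms by auto
  have "j div d = (if j < d then 0 else if j < 2 * d then 1 else 2)"
    using assms(1) by (auto intro!: div_nat_eqI)
  then show ?thesis using assms(1) by (auto simp: anchor_def h)
qed

text \<open>In the sum of the five constraints for \<open>000\<close>, \<open>110\<close>, \<open>011\<close>, \<open>101\<close> and \<open>111\<close>, every node's
  contributions cancel modulo 2 because its output depends on a single bit; the right-hand sides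
  add up to 3.\<close>

lemma no_local_parity:
  fixes m :: "(nat \<Rightarrow> bool) \<Rightarrow> nat \<Rightarrow> bool"
  assumes d: "0 < d" "even d"
    and local: "\<And>b b' j. j < 3 * d \<Longrightarrow> b (anchor d j) = b' (anchor d j) \<Longrightarrow> m b j = m b' j"
    and nz: "\<And>b. b \<in> bitstrings 3 \<Longrightarrow> final_amp d b (m b) \<noteq> 0"
  shows False
proof -
  define zero one :: "nat \<Rightarrow> bool" where "zero = (\<lambda>i. False)" and "one = (\<lambda>i. i < 3)"
  define two :: "nat \<Rightarrow> nat \<Rightarrow> bool" where "two = (\<lambda>k i. i < 3 \<and> (i = k \<or> i = (k + 1) mod 3))"
  have c: "card {j. j < 3 * d \<and> m b j \<and> P j} = (\<Sum>j<3 * d. of_bool (m b j \<and> P j))" for b P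
    by (subst sum_of_bool_eq) (auto intro!: arg_cong[where f=card])
  have "even (\<Sum>j<3 * d. of_bool (m zero j \<and> even j) :: nat)"
    unfolding c[symmetric]
    by (intro final_amp_even_parity[OF d nz]) (auto simp: zero_def bitstrings_def)
  moreover have "even (\<Sum>j<3 * d. of_bool (m one j \<and> odd j) :: nat)"
    unfolding c[symmetric]
    by (intro final_amp_odd_parity[OF d nz]) (auto simp: one_def bitstrings_def)
  moreover have "odd (\<Sum>j<3 * d. of_bool (m (two k) j \<and> (even j \<or> j div d = k)) :: nat)"
    if "k < 3" for k
    unfolding c[symmetric]
    by (intro final_amp_segment_parity[OF d nz that]) (auto simp: two_def bitstrings_def)
  moreover have "even (\<Sum>j<3 * d. of_bool (m zero j \<and> even j) + of_bool (m one j \<and> odd j)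
     + (of_bool (m (two 0) j \<and> (even j \<or> j div d = 0)) + of_bool (m (two 1) j \<and> (even j \<or> j div d = 1))
     + of_bool (m (two 2) j \<and> (even j \<or> j div d = 2))) :: nat)"
  proof (rule dvd_sum)
    fix j assume "j \<in> {..<3 * d}"
    then have j: "j < 3 * d" by simp
    define a where "a = anchor d j"
    define g where "g = (\<lambda>c. m (\<lambda>_. c) j)"
    have mg: "m b j = g (b a)" for b
      unfolding g_def a_def by (rule local[OF j]) simp
    have "j div d < 3" using j by (simp add: less_mult_imp_div_less)
    then consider "j div d = 0" | "j div d = 1" | "j div d = 2" by linarith
    moreover have "a = j div d \<or> a = (j div d + 1) mod 3"
      unfolding a_def by (rule anchor_segment[OF j d(2)])
    \<comment> \<open>For even \<open>j\<close>, two of the three \<open>two k\<close> are true at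
      \<open>a\<close>, so \<open>g False\<close> and \<open>g True\<close> each occur twice. For
      odd \<open>j\<close> only k = j div d counts, and \<open>a\<close> is an end of that segment,
      so \<open>g True\<close> occurs twice.\<close>
    ultimately show "even (of_bool (m zero j \<and> even j) + of_bool (m one j \<and> odd j)
      + (of_bool (m (two 0) j \<and> (even j \<or> j div d = 0)) + of_bool (m (two 1) j \<and> (even j \<or> j div d = 1))
      + of_bool (m (two 2) j \<and> (even j \<or> j div d = 2))) :: nat)"
      unfolding mg by cases (auto simp: zero_def one_def two_def)
  qed
  ultimately show False
    unfolding sum.distrib by simp
qed

section \<open>The optimisation over the leaf bits\<close>

text \<open>By AM-GM, \<open>v / q + 7 * q \<ge> 2 * sqrt (7 * v)\<close>; the constants are a rounded chord of the concave
  right-hand side over \<open>[1/8 - 1/11, 1/8]\<close>.\<close>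

lemma eight_weights_term:
  fixes q v :: real
  assumes "0 < q" "3/88 \<le> v" "v \<le> 1/8"
  shows "16/25 + 49/5 * v - 7 * q \<le> v / q"
proof -
  \<comment> \<open>The chord of v^2 over the interval, where 3/88 = 1/8 - 1/11.\<close>
  have "0 \<le> (v - 3/88) * (1/8 - v)" using assms by simp
  also have "\<dots> = 7/44 * v - 3/704 - v * v" by (simp add: field_simps)
  finally have "v * v \<le> 7/44 * v - 3/704" by simp
  moreover have "(16/25 + 49/5 * v)\<^sup>2 = 256/625 + 1568/125 * v + 2401/25 * (v * v)"
    by (simp add: power2_eq_square algebra_simps)
  ultimately have "(16/25 + 49/5 * v)\<^sup>2 \<le> 28 * v"
    using assms(2,3) by linarith
  \<comment> \<open>AM-GM in polynomial form: division by 28 gives the claim.\<close>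
  moreover have "0 \<le> (14 * q - (16/25 + 49/5 * v))\<^sup>2" by simp
  ultimately have "(16/25 + 49/5 * v - 7 * q) * q \<le> v"
    by (simp add: power2_eq_square algebra_simps)
  with assms(1) show ?thesis by (simp add: pos_le_divide_eq)
qed

text \<open>If the sum were below 1/11, every min (1/8) (w b) would lie in [3/88, 1/8], where the
  pointwise bound applies; summing it contradicts \<open>w\<close>.\<close>

lemma eight_weights:
  fixes q w :: "'a \<Rightarrow> real"
  assumes B: "finite B" "card B = 8"
    and q: "\<And>b. b \<in> B \<Longrightarrow> 0 < q b" "(\<Sum>b\<in>B. q b) \<le> 1"
    and w: "(\<Sum>b\<in>B. w b / q b) \<le> 7"
  shows "1/11 \<le> (\<Sum>b\<in>B. max 0 (1/8 - w b))"
proof (rule ccontr)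
  assume "\<not> 1/11 \<le> (\<Sum>b\<in>B. max 0 (1/8 - w b))"
  then have less: "(\<Sum>b\<in>B. max 0 (1/8 - w b)) < 1/11" by simp
  have "16/25 + 49/5 * (1/8 - max 0 (1/8 - w b)) - 7 * q b \<le> w b / q b" if b: "b \<in> B" for b
  proof -
    have "max 0 (1/8 - w b) \<le> (\<Sum>b\<in>B. max 0 (1/8 - w b))"
      using b B by (intro member_le_sum[where f="\<lambda>b. max 0 (1/8 - w b)"]) auto
    then have "max 0 (1/8 - w b) < 1/11" using less by (rule le_less_trans)
    then have "3/88 \<le> 1/8 - max 0 (1/8 - w b)" by (simp add: field_simps)
    then have "16/25 + 49/5 * (1/8 - max 0 (1/8 - w b)) - 7 * q b \<le> (1/8 - max 0 (1/8 - w b)) / q b"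
      using q(1)[OF b] by (intro eight_weights_term) auto
    also have "\<dots> \<le> w b / q b"
      using q(1)[OF b] by (intro divide_right_mono) auto
    finally show ?thesis .
  qed
  \<comment> \<open>373/200 = 16/25 + 49/5 * 1/8.\<close>
  then have "(\<Sum>b\<in>B. 373/200 - 49/5 * max 0 (1/8 - w b) - 7 * q b) \<le> (\<Sum>b\<in>B. w b / q b)"
    by (intro sum_mono) (simp add: field_simps)
  then have "8 * (373/200) - 49/5 * (\<Sum>b\<in>B. max 0 (1/8 - w b)) - 7 * (\<Sum>b\<in>B. q b) \<le> 7"
    using w B(2) by (simp only: sum_subtractf sum_distrib_left[symmetric] sum_constant)
  with less q(2) show False by linarith
qed

section \<open>Total variation distance and leaf outputs\<close>

lemma nodes_eq: "nodes d = V ` {..<3 * d} \<union> W ` {..<3}"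
  by (auto simp: nodes_def)

lemma finite_nodes: "finite (nodes d)"
  by (simp add: nodes_eq)

lemma finite_outputs: "finite (outputs d)"
proof (rule finite_subset)
  show "outputs d \<subseteq> (\<lambda>A u. u \<in> A) ` Pow (nodes d)"
  proof
    fix out assume "out \<in> outputs d"
    then have "{u. out u} \<in> Pow (nodes d)" "out = (\<lambda>u. u \<in> {u. out u})"
      by (auto simp: outputs_def)
    then show "out \<in> (\<lambda>A u. u \<in> A) ` Pow (nodes d)" by blast
  qed
qed (simp add: finite_nodes)

definition bits :: "(node \<Rightarrow> bool) \<Rightarrow> nat \<Rightarrow> bool" where
  "bits out = (\<lambda>i. out (W i))"

definition outcome :: "nat \<Rightarrow> (node \<Rightarrow> bool) \<Rightarrow> nat \<Rightarrow> bool" where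
  "outcome d out = (\<lambda>j. if j < 3 * d then out (V j) else False)"

definition with_bits :: "nat \<Rightarrow> (nat \<Rightarrow> bool) \<Rightarrow> (node \<Rightarrow> bool) set" where
  "with_bits d b = {out \<in> outputs d. bits out = b}"

lemma bits_in_bitstrings: "out \<in> outputs d \<Longrightarrow> bits out \<in> bitstrings 3"
  by (auto simp: outputs_def bits_def bitstrings_def nodes_def)

lemma finite_with_bits: "finite (with_bits d b)"
  using finite_outputs by (simp add: with_bits_def)

lemma sum_outputs_group:
  fixes g :: "(node \<Rightarrow> bool) \<Rightarrow> real"
  shows "(\<Sum>b\<in>bitstrings 3. \<Sum>out\<in>with_bits d b. g out) = (\<Sum>out\<in>outputs d. g out)"
  unfolding with_bits_def
  by (rule sum.group) (auto simp: finite_outputs finite_bitstrings bits_in_bitstrings)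

lemma Gamma_dist_eq:
  "out \<in> outputs d \<Longrightarrow> Gamma_dist d out = 1/8 * proc_prob d (bits out) (outcome d out)"
  by (simp add: Gamma_dist_def bits_def outcome_def)

text \<open>With the leaf bits fixed, outputs correspond to outcomes of the process, whose
  probabilities sum to 1.\<close>

lemma sum_Gamma_dist_with_bits:
  assumes "b \<in> bitstrings 3"
  shows "(\<Sum>out\<in>with_bits d b. Gamma_dist d out) = 1/8"
proof -
  let ?mk = "\<lambda>m u. case u of V j \<Rightarrow> m j | W i \<Rightarrow> b i"
  have "(\<Sum>out\<in>with_bits d b. Gamma_dist d out) = (\<Sum>m\<in>bitstrings (3 * d). 1/8 * proc_prob d b m)"
  proof (rule sum.reindex_bij_witness[of _ ?mk "outcome d"])
    fix out assume out: "out \<in> with_bits d b"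
    then have o: "out \<in> outputs d" "bits out = b" by (auto simp: with_bits_def)
    show "?mk (outcome d out) = out"
    proof
      fix u show "?mk (outcome d out) u = out u"
        using o by (cases u) (auto simp: outputs_def outcome_def bits_def nodes_def)
    qed
    show "outcome d out \<in> bitstrings (3 * d)" by (simp add: outcome_def bitstrings_def)
    show "1/8 * proc_prob d b (outcome d out) = Gamma_dist d out"
      using o by (simp add: Gamma_dist_eq)
  next
    fix m assume m: "m \<in> bitstrings (3 * d)"
    have "\<not> ?mk m u" if "u \<notin> nodes d" for u
      using that m assms by (cases u) (auto simp: nodes_def bitstrings_def)
    then show "?mk m \<in> with_bits d b"
      by (simp add: with_bits_def outputs_def bits_def)
    show "outcome d (?mk m) = m"
    proof
      fix j show "outcome d (?mk m) j = m j"
        using m by (cases "j < 3 * d") (auto simp: outcome_def bitstrings_def)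
    qed
  qed
  also have "\<dots> = 1/8" by (simp only: sum_distrib_left[symmetric] sum_proc_prob)
  finally show ?thesis .
qed

lemma sum_Gamma_dist: "(\<Sum>out\<in>outputs d. Gamma_dist d out) = 1"
proof -
  have "(\<Sum>out\<in>outputs d. Gamma_dist d out) = (\<Sum>b\<in>bitstrings 3. 1/8)"
    unfolding sum_outputs_group[symmetric]
    by (intro sum.cong refl sum_Gamma_dist_with_bits)
  then show ?thesis by (simp add: card_bitstrings)
qed

lemma joint_output_in_outputs: "joint_output d f \<omega> \<in> outputs d"
  by (simp add: joint_output_def outputs_def)

lemma measurable_joint_output:
  assumes "local_alg d T f"
  shows "joint_output d f \<in> measurable coin_space (count_space (outputs d))"
proof (subst measurable_count_space_eq2[OF finite_outputs], intro conjI ballI)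
  show "joint_output d f \<in> space coin_space \<rightarrow> outputs d"
    by (simp add: joint_output_in_outputs)
  fix out assume out: "out \<in> outputs d"
  have "f u -` {out u} \<inter> space coin_space \<in> sets coin_space" if "u \<in> nodes d" for u
    using assms that unfolding local_alg_def by (intro measurable_sets) auto
  moreover have "W 0 \<in> nodes d" by (simp add: nodes_def)
  then have "nodes d \<noteq> {}" by blast
  ultimately have "(\<Inter>u\<in>nodes d. f u -` {out u} \<inter> space coin_space) \<in> sets coin_space"
    by (intro sets.finite_INT finite_nodes) auto
  also have "(\<Inter>u\<in>nodes d. f u -` {out u} \<inter> space coin_space)
      = joint_output d f -` {out} \<inter> space coin_space"
  proof -
    have "joint_output d f \<omega> = out \<longleftrightarrow> (\<forall>u\<in>nodes d. f u \<omega> = out u)" for \<omega>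
    proof
      assume "\<forall>u\<in>nodes d. f u \<omega> = out u"
      with out show "joint_output d f \<omega> = out"
        by (intro ext) (simp add: joint_output_def outputs_def)
    qed (auto simp: joint_output_def)
    then show ?thesis using \<open>nodes d \<noteq> {}\<close> by (simp add: vimage_def INT_simps) blast
  qed
  finally show "joint_output d f -` {out} \<inter> space coin_space \<in> sets coin_space" .
qed

lemma sets_joint_output:
  assumes "local_alg d T f" "A \<subseteq> outputs d"
  shows "{\<omega>. joint_output d f \<omega> \<in> A} \<in> sets coin_space"
  using measurable_sets[OF measurable_joint_output[OF assms(1)], of A] assms(2)
  by (simp add: vimage_def)

lemma measure_joint_output:
  assumes "local_alg d T f" "A \<subseteq> outputs d"
  shows "measure coin_space {\<omega>. joint_output d f \<omega> \<in> A} = (\<Sum>out\<in>A. alg_prob d f out)"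
proof -
  interpret prob_space coin_space by (rule prob_space_coin_space)
  have "{\<omega>. joint_output d f \<omega> \<in> A} = (\<Union>out\<in>A. {\<omega>. joint_output d f \<omega> = out})"
    by auto
  also have "measure coin_space \<dots> = (\<Sum>out\<in>A. measure coin_space {\<omega>. joint_output d f \<omega> = out})"
  proof (rule finite_measure_finite_Union)
    show "finite A" using assms(2) finite_outputs by (rule finite_subset)
    show "(\<lambda>out. {\<omega>. joint_output d f \<omega> = out}) ` A \<subseteq> sets coin_space"
      using sets_joint_output[OF assms(1), of "{_}"] assms(2) by auto
    show "disjoint_family_on (\<lambda>out. {\<omega>. joint_output d f \<omega> = out}) A"
      by (auto simp: disjoint_family_on_def)
  qed
  finally show ?thesis by (simp add: alg_prob_def)
qed

lemma sum_alg_prob: "local_alg d T f \<Longrightarrow> (\<Sum>out\<in>outputs d. alg_prob d f out) = 1"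
  using measure_joint_output[of d T f "outputs d"] prob_space.prob_space[OF prob_space_coin_space]
  by (simp add: joint_output_in_outputs)

text \<open>Equal total masses make the positive and negative parts of the difference equal.\<close>

lemma tv_dist_eq_sum_max:
  assumes "(\<Sum>x\<in>X. p x) = (\<Sum>x\<in>X. q x)"
  shows "tv_dist p q X = (\<Sum>x\<in>X. max 0 (q x - p x))"
proof -
  have "(\<Sum>x\<in>X. \<bar>p x - q x\<bar>) = (\<Sum>x\<in>X. 2 * max 0 (q x - p x) + (p x - q x))"
    by (intro sum.cong refl) (simp add: max_def abs_if)
  then show ?thesis
    using assms by (simp add: tv_dist_def sum.distrib sum_subtractf sum_distrib_left[symmetric])
qed

definition possible :: "nat \<Rightarrow> (nat \<Rightarrow> bool) \<Rightarrow> (node \<Rightarrow> bool) set" where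
  "possible d b = {out \<in> with_bits d b. Gamma_dist d out \<noteq> 0}"

text \<open>For each \<open>b\<close>, \<Gamma> has its whole mass 1/8 on
  \<open>possible d b\<close>, so the algorithm's shortfall there counts towards the distance;
  distinct \<open>b\<close> give disjoint sets.\<close>

lemma tv_dist_Gamma_ge:
  assumes "local_alg d T f"
  shows "(\<Sum>b\<in>bitstrings 3. max 0 (1/8 - (\<Sum>out\<in>possible d b. alg_prob d f out)))
     \<le> tv_dist (alg_prob d f) (Gamma_dist d) (outputs d)"
proof -
  have "max 0 (1/8 - (\<Sum>out\<in>possible d b. alg_prob d f out))
      \<le> (\<Sum>out\<in>with_bits d b. max 0 (Gamma_dist d out - alg_prob d f out))"
    if b: "b \<in> bitstrings 3" for b
  proof (rule max.boundedI)
    show "0 \<le> (\<Sum>out\<in>with_bits d b. max 0 (Gamma_dist d out - alg_prob d f out))"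
      by (intro sum_nonneg) auto
    have "(\<Sum>out\<in>possible d b. Gamma_dist d out) = (\<Sum>out\<in>with_bits d b. Gamma_dist d out)"
      by (intro sum.mono_neutral_left) (auto simp: possible_def finite_with_bits)
    then have "1/8 - (\<Sum>out\<in>possible d b. alg_prob d f out)
        = (\<Sum>out\<in>possible d b. Gamma_dist d out - alg_prob d f out)"
      by (simp only: sum_subtractf sum_Gamma_dist_with_bits[OF b])
    also have "\<dots> \<le> (\<Sum>out\<in>possible d b. max 0 (Gamma_dist d out - alg_prob d f out))"
      by (intro sum_mono) auto
    also have "\<dots> \<le> (\<Sum>out\<in>with_bits d b. max 0 (Gamma_dist d out - alg_prob d f out))"
      by (intro sum_mono2) (auto simp: possible_def finite_with_bits)
    finally show "1/8 - (\<Sum>out\<in>possible d b. alg_prob d f out)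
        \<le> (\<Sum>out\<in>with_bits d b. max 0 (Gamma_dist d out - alg_prob d f out))" .
  qed
  then show ?thesis
    unfolding tv_dist_eq_sum_max[OF trans[OF sum_alg_prob[OF assms] sum_Gamma_dist[symmetric]]]
      sum_outputs_group[symmetric]
    by (rule sum_mono)
qed

section \<open>Coins exchanged around the leaves\<close>

definition leaf_nodes :: "nat \<Rightarrow> nat \<Rightarrow> (nat \<Rightarrow> bool) \<Rightarrow> node set" where
  "leaf_nodes d T b = {x. \<exists>i<3. b i \<and> x \<in> ball d T (W i)}"

definition mixed_coins ::
  "nat \<Rightarrow> nat \<Rightarrow> (nat \<Rightarrow> bool) \<Rightarrow> bool \<Rightarrow> ((node \<times> nat) \<times> bool \<Rightarrow> bool) \<Rightarrow> node \<times> nat \<Rightarrow> bool" where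
  "mixed_coins d T b c \<Omega> = copy c (swap_copies (leaf_nodes d T b) \<Omega>)"

lemma local_algD:
  assumes "local_alg d T f" "u \<in> nodes d" "\<And>x k. x \<in> ball d T u \<Longrightarrow> \<omega> (x, k) = \<omega>' (x, k)"
  shows "f u \<omega> = f u \<omega>'"
  using assms unfolding local_alg_def by blast

text \<open>The ball of \<open>W i\<close> lies inside \<open>leaf_nodes d T b\<close> or misses it,
  according to \<open>b i\<close>, as balls of distinct leaves are disjoint.\<close>

lemma leaf_output_mixed:
  assumes f: "local_alg d T f" and T: "4 * T \<le> d" and i: "i < 3"
  shows "f (W i) (mixed_coins d T b c \<Omega>) = f (W i) (copy (c \<noteq> b i) \<Omega>)"
proof (rule local_algD[OF f])
  show "W i \<in> nodes d" using i by (simp add: nodes_def)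
  fix x k assume x: "x \<in> ball d T (W i)"
  have "x \<in> leaf_nodes d T b \<longleftrightarrow> b i"
  proof
    assume "x \<in> leaf_nodes d T b"
    then obtain k where k: "k < 3" "b k" "x \<in> ball d T (W k)"
      unfolding leaf_nodes_def by blast
    with leaf_balls_disjoint[OF k(3) x k(1) i T] show "b i" by simp
  next
    assume "b i"
    with x i show "x \<in> leaf_nodes d T b" unfolding leaf_nodes_def by blast
  qed
  then show "mixed_coins d T b c \<Omega> (x, k) = copy (c \<noteq> b i) \<Omega> (x, k)"
    unfolding mixed_coins_def copy_swap_copies by (cases "b i") simp_all
qed

text \<open>The ball of \<open>V j\<close> can meet the ball of no leaf but its anchor's, so only
  that bit decides which of its coins are exchanged.\<close>

lemma cycle_output_mixed:
  assumes f: "local_alg d T f" and T: "4 * T \<le> d" "even d" and j: "j < 3 * d"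
    and b: "b (anchor d j) = b' (anchor d j)"
  shows "f (V j) (mixed_coins d T b c \<Omega>) = f (V j) (mixed_coins d T b' c \<Omega>)"
proof (rule local_algD[OF f])
  show "V j \<in> nodes d" using j by (simp add: nodes_def)
  fix x k assume x: "x \<in> ball d T (V j)"
  have "b i = b' i" if "i < 3" "x \<in> ball d T (W i)" for i
    using b cycle_leaf_balls[OF x that(2) j that(1) T] by simp
  then have "x \<in> leaf_nodes d T b \<longleftrightarrow> x \<in> leaf_nodes d T b'"
    unfolding leaf_nodes_def by blast
  then show "mixed_coins d T b c \<Omega> (x, k) = mixed_coins d T b' c \<Omega> (x, k)"
    unfolding mixed_coins_def copy_swap_copies by simp
qed

section \<open>The coupling argument\<close>

text \<open>The exchange preserves the joint law, so for each fixed \<open>b\<close> the two mixed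
  assignments are again independent fair coins.\<close>

lemma measure_mixed_outputs:
  assumes f: "local_alg d T f" and AB: "A \<subseteq> outputs d" "B \<subseteq> outputs d"
  shows "{\<Omega>. joint_output d f (mixed_coins d T b False \<Omega>) \<in> A \<and>
      joint_output d f (mixed_coins d T b True \<Omega>) \<in> B} \<in> sets double_coins" (is "?S \<in> _")
    and "measure double_coins {\<Omega>. joint_output d f (mixed_coins d T b False \<Omega>) \<in> A \<and>
      joint_output d f (mixed_coins d T b True \<Omega>) \<in> B}
    = (\<Sum>out\<in>A. alg_prob d f out) * (\<Sum>out\<in>B. alg_prob d f out)"
proof -
  let ?X = "{\<omega>. joint_output d f \<omega> \<in> A}" and ?Y = "{\<omega>. joint_output d f \<omega> \<in> B}"
  let ?R = "{\<Omega>. copy False \<Omega> \<in> ?X \<and> copy True \<Omega> \<in> ?Y}"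
  have XY: "?X \<in> sets coin_space" "?Y \<in> sets coin_space"
    using sets_joint_output[OF f] AB by blast+
  have "copy False -` ?X \<inter> space double_coins \<inter> (copy True -` ?Y \<inter> space double_coins)
      \<in> sets double_coins"
    by (intro sets.Int measurable_sets[OF measurable_copy] XY)
  also have "copy False -` ?X \<inter> space double_coins \<inter> (copy True -` ?Y \<inter> space double_coins) = ?R"
    by auto
  finally have R: "?R \<in> sets double_coins" .
  have S: "?S = {\<Omega>. swap_copies (leaf_nodes d T b) \<Omega> \<in> ?R}"
    by (simp add: mixed_coins_def)
  have "?S = swap_copies (leaf_nodes d T b) -` ?R \<inter> space double_coins"
    unfolding S by auto
  then show "?S \<in> sets double_coins"
    using measurable_sets[OF measurable_swap_copies R] by (simp only:)
  show "measure double_coins ?S = (\<Sum>out\<in>A. alg_prob d f out) * (\<Sum>out\<in>B. alg_prob d f out)"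
    unfolding S measure_swap_copies[OF R] measure_copies[OF XY]
    by (simp only: measure_joint_output[OF f AB(1)] measure_joint_output[OF f AB(2)])
qed

lemma joint_output_in_with_bits:
  assumes "b \<in> bitstrings 3"
  shows "joint_output d f \<omega> \<in> with_bits d b \<longleftrightarrow> (\<forall>i<3. f (W i) \<omega> = b i)"
proof -
  have "bits (joint_output d f \<omega>) = (\<lambda>i. i < 3 \<and> f (W i) \<omega>)"
    by (auto simp: bits_def joint_output_def nodes_def)
  moreover have "i < 3" if "b i" for i
  proof (rule ccontr)
    assume "\<not> i < 3"
    with that assms show False by (simp add: bitstrings_def)
  qed
  ultimately show ?thesis
    by (auto simp: with_bits_def joint_output_in_outputs fun_eq_iff)
qed

text \<open>The two independent coin assignments are conditioned on giving \<open>000\<close> and \<open>111\<close> at the leaves.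
  Exchanging them around the leaves in \<open>b\<close> preserves their joint law, makes the leaves output \<open>b\<close>
  in the first copy and its complement in the second, and lets each cycle node see a single bit of
  \<open>b\<close>. By \<open>no_local_parity\<close> some \<open>b\<close> then gives an outcome of probability zero under \<open>\<Gamma>\<^sub>d\<close>.\<close>

lemma exists_impossible_mixture:
  assumes f: "local_alg d T f" and T: "4 * T \<le> d" and d: "0 < d" "even d"
    and zero_one: "\<And>i. i < 3 \<Longrightarrow> \<not> f (W i) (copy False \<Omega>)" "\<And>i. i < 3 \<Longrightarrow> f (W i) (copy True \<Omega>)"
  shows "\<exists>b\<in>bitstrings 3. joint_output d f (mixed_coins d T b False \<Omega>) \<in> with_bits d b - possible d b"
proof (rule ccontr)
  assume none: "\<not> ?thesis"
  have *: "joint_output d f (mixed_coins d T b False \<Omega>) \<in> possible d b"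
    if b: "b \<in> bitstrings 3" for b
  proof -
    have "f (W i) (mixed_coins d T b False \<Omega>) = b i" if "i < 3" for i
      unfolding leaf_output_mixed[OF f T that] using zero_one[OF that] by (cases "b i") auto
    then have "joint_output d f (mixed_coins d T b False \<Omega>) \<in> with_bits d b"
      unfolding joint_output_in_with_bits[OF b] by blast
    with none b show ?thesis by blast
  qed
  show False
  proof (rule no_local_parity[OF d])
    show "outcome d (joint_output d f (mixed_coins d T b False \<Omega>)) j
        = outcome d (joint_output d f (mixed_coins d T b' False \<Omega>)) j"
      if "j < 3 * d" "b (anchor d j) = b' (anchor d j)" for b b' j
      using cycle_output_mixed[where b=b and b'=b', OF f T d(2) that] by (simp add: outcome_def joint_output_def)
    show "final_amp d b (outcome d (joint_output d f (mixed_coins d T b False \<Omega>))) \<noteq> 0"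
      if "b \<in> bitstrings 3" for b
      using *[OF that] Gamma_dist_eq[OF joint_output_in_outputs, of d f]
      by (auto simp: possible_def with_bits_def proc_prob_def)
  qed
qed

text \<open>Here \<open>g\<close> is the probability that the copies give 000 and 111 at the leaves.
  After mixing by any \<open>b\<close> this same event reads as leaf outputs \<open>b\<close> and
  \<open>neg b\<close>, hence the product formula; the second bound is a union bound over
  \<open>b\<close>.\<close>

lemma coupling_bound:
  assumes f: "local_alg d T f" and T: "4 * T \<le> d" and d: "0 < d" "even d"
  defines "q \<equiv> \<lambda>b. \<Sum>out\<in>with_bits d b. alg_prob d f out"
    and "w \<equiv> \<lambda>b. \<Sum>out\<in>possible d b. alg_prob d f out"
    and "neg \<equiv> \<lambda>b i. i < 3 \<and> \<not> b i"
  obtains g where "\<And>b. b \<in> bitstrings 3 \<Longrightarrow> q b * q (neg b) = g"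
    and "g \<le> (\<Sum>b\<in>bitstrings 3. (q b - w b) * q (neg b))"
proof
  interpret prob_space double_coins by (rule prob_space_double_coins)
  let ?out = "\<lambda>b c \<Omega>. joint_output d f (mixed_coins d T b c \<Omega>)"
  define G where "G = {\<Omega>. \<forall>i<3. \<not> f (W i) (copy False \<Omega>) \<and> f (W i) (copy True \<Omega>)}"
  have sub: "with_bits d b \<subseteq> outputs d" "with_bits d b - possible d b \<subseteq> outputs d" for b
    by (auto simp: with_bits_def)
  have neg: "neg b \<in> bitstrings 3" for b
    by (simp add: neg_def bitstrings_def)
  have G: "G = {\<Omega>. ?out b False \<Omega> \<in> with_bits d b \<and> ?out b True \<Omega> \<in> with_bits d (neg b)}"
    if b: "b \<in> bitstrings 3" for b
  proof -
    have "(\<not> f (W i) (copy False \<Omega>) \<and> f (W i) (copy True \<Omega>)) =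
        (f (W i) (mixed_coins d T b False \<Omega>) = b i \<and> f (W i) (mixed_coins d T b True \<Omega>) = neg b i)"
      if "i < 3" for i \<Omega>
      using that unfolding leaf_output_mixed[OF f T that] neg_def by (cases "b i") auto
    then show ?thesis
      unfolding G_def joint_output_in_with_bits[OF b] joint_output_in_with_bits[OF neg] by blast
  qed
  show "q b * q (neg b) = measure double_coins G" if b: "b \<in> bitstrings 3" for b
    unfolding G[OF b] measure_mixed_outputs(2)[OF f sub(1) sub(1)] q_def ..
  let ?bad = "\<lambda>b. {\<Omega>. ?out b False \<Omega> \<in> with_bits d b - possible d b \<and> ?out b True \<Omega> \<in> with_bits d (neg b)}"
  have bad: "?bad b \<in> events" for b
    by (rule measure_mixed_outputs(1)[OF f sub(2) sub(1)])
  have "G \<subseteq> (\<Union>b\<in>bitstrings 3. ?bad b)"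
  proof
    fix \<Omega> assume \<Omega>: "\<Omega> \<in> G"
    then obtain b where b: "b \<in> bitstrings 3" "?out b False \<Omega> \<in> with_bits d b - possible d b"
      using exists_impossible_mixture[OF f T d, of \<Omega>] by (auto simp: G_def)
    with \<Omega> G[OF b(1)] show "\<Omega> \<in> (\<Union>b\<in>bitstrings 3. ?bad b)" by blast
  qed
  then have "prob G \<le> prob (\<Union>b\<in>bitstrings 3. ?bad b)"
    by (intro finite_measure_mono sets.finite_UN finite_bitstrings bad)
  also have "\<dots> \<le> (\<Sum>b\<in>bitstrings 3. prob (?bad b))"
    by (intro finite_measure_subadditive_finite finite_bitstrings) (use bad in blast)
  also have "\<dots> = (\<Sum>b\<in>bitstrings 3. (q b - w b) * q (neg b))"
  proof (rule sum.cong[OF refl])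
    fix b :: "nat \<Rightarrow> bool"
    have "(\<Sum>out\<in>with_bits d b - possible d b. alg_prob d f out) = q b - w b"
      unfolding q_def w_def
      by (intro sum_diff finite_with_bits) (auto simp: possible_def)
    then show "prob (?bad b) = (q b - w b) * q (neg b)"
      unfolding measure_mixed_outputs(2)[OF f sub(2) sub(1)] by (simp add: q_def)
  qed
  finally show "prob G \<le> (\<Sum>b\<in>bitstrings 3. (q b - w b) * q (neg b))" .
qed

theorem theorem5:
  fixes d T :: nat and f :: "node \<Rightarrow> (node \<times> nat \<Rightarrow> bool) \<Rightarrow> bool"
  assumes "even d" and "d \<ge> 2" and "real T \<le> real d / 4"
    and "local_alg d T f"
  shows "tv_dist (alg_prob d f) (Gamma_dist d) (outputs d) \<ge> 1/11"
proof -
  let ?B = "bitstrings 3"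
  define q where "q = (\<lambda>b. \<Sum>out\<in>with_bits d b. alg_prob d f out)"
  define w where "w = (\<lambda>b. \<Sum>out\<in>possible d b. alg_prob d f out)"
  define neg :: "(nat \<Rightarrow> bool) \<Rightarrow> nat \<Rightarrow> bool" where "neg = (\<lambda>b i. i < 3 \<and> \<not> b i)"
  have T: "4 * T \<le> d" using assms(3) by linarith
  have d: "0 < d" using assms(2) by simp
  obtain g where g: "\<And>b. b \<in> ?B \<Longrightarrow> q b * q (neg b) = g"
    and g_le: "g \<le> (\<Sum>b\<in>?B. (q b - w b) * q (neg b))"
    using coupling_bound[OF assms(4) T d assms(1)] unfolding q_def w_def neg_def by blast
  have p: "0 \<le> alg_prob d f out" for out
    by (simp add: alg_prob_def)
  have q0: "0 \<le> q b" and wq: "w b \<le> q b" for b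
    unfolding q_def w_def
    by (auto intro!: sum_nonneg sum_mono2 p finite_with_bits simp: possible_def)
  have q1: "(\<Sum>b\<in>?B. q b) = 1"
    unfolding q_def sum_outputs_group by (rule sum_alg_prob[OF assms(4)])
  have neg: "neg b \<in> ?B" for b by (simp add: neg_def bitstrings_def)
  have "1/11 \<le> (\<Sum>b\<in>?B. max 0 (1/8 - w b))"
  proof (cases "g = 0")
    case True
    have "(\<lambda>i. False) \<in> ?B" by (simp add: bitstrings_def)
    \<comment> \<open>000 or 111 has leaf probability 0; its shortfall alone is at least
      1/8.\<close>
    from True g[OF this] this neg obtain b where b: "b \<in> ?B" "q b = 0" by auto
    with wq[of b] have "1/11 \<le> max 0 (1/8 - w b)" by simp
    also have "\<dots> \<le> (\<Sum>b\<in>?B. max 0 (1/8 - w b))"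
      using b(1) finite_bitstrings by (intro member_le_sum[where f="\<lambda>b. max 0 (1/8 - w b)"]) auto
    finally show ?thesis .
  next
    case False
    have qpos: "0 < q b" if "b \<in> ?B" for b
      using q0[of b] g[OF that] False by (cases "q b = 0") auto
    have "0 \<le> g"
      using mult_nonneg_nonneg[OF q0 q0, of "neg (\<lambda>_. False)" "neg (neg (\<lambda>_. False))"]
      by (simp only: g[OF neg])
    with False have gpos: "0 < g" by simp
    \<comment> \<open>Since q b * q (neg b) = g for all \<open>b\<close>, dividing by
      \<open>g\<close> leaves the conditional violation probabilities 1 - w b / q b, which thus sum
      to at least 1.\<close>
    have "g \<le> (\<Sum>b\<in>?B. (1 - w b / q b) * g)"
    proof (rule order_trans[OF g_le], rule sum_mono)
      fix b assume b: "b \<in> ?B"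
      have "(1 - w b / q b) * g = (1 - w b / q b) * q b * q (neg b)"
        by (simp add: g[OF b])
      also have "(1 - w b / q b) * q b = q b - w b"
        using qpos[OF b] by (simp add: algebra_simps)
      finally show "(q b - w b) * q (neg b) \<le> (1 - w b / q b) * g" by simp
    qed
    then have "1 * g \<le> (\<Sum>b\<in>?B. 1 - w b / q b) * g"
      by (simp add: sum_distrib_right)
    then have "1 \<le> (\<Sum>b\<in>?B. 1 - w b / q b)"
      using gpos by (rule mult_right_le_imp_le)
    then have "(\<Sum>b\<in>?B. w b / q b) \<le> 7"
      by (simp add: sum_subtractf card_bitstrings)
    then show ?thesis
      using q1 qpos finite_bitstrings card_bitstrings by (intro eight_weights[of ?B q]) auto
  qed
  also have "\<dots> \<le> tv_dist (alg_prob d f) (Gamma_dist d) (outputs d)"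
    unfolding w_def by (rule tv_dist_Gamma_ge[OF assms(4)])
  finally show ?thesis .
qed

end
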